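(* Let $\Pi$ be a $\overline{C}$-type presentation of a group $G$ such that all its generators fall into the same conjugacy class of $G$. Then $G^{\mathcal{D}}$ decomposes as a semi-direct product $$G^{\mathcal{D}}\ \cong\ G'\rtimes\mathbb{Z},$$ where $G'$ is the derived subgroup of $G$ and $1\in\mathbb{Z}$ acts on $G'$ by conjugation by a chosen generator $a$ of $\Pi$.
   Context: A $\overline{C}$-type presentation $\Pi$ of a group $G$, with generator set $\Gamma$, is a presentation in which every relation is either a conjugation relation $b^{-1}ab=c$ with $a,b,c\in\Gamma$, or a power relation $a^k=1$ with $a\in\Gamma$, $k\ge 2$; there is at most one power relation per conjugacy class of $G$ (i.e., for each conjugacy class $\mathcal{O}$ of $G$, at most one power relation $a^k=1$ has $a\in\mathcal{O}$). The Dehn quandle $\Gamma^G$ is the union of the $G$-conjugacy classes of the elements of $\Gamma$ in $G$, with the operation $a\triangleleft b=b^{-1}ab$, and $G^{\mathcal{D}}:=\mathrm{As}(\Gamma^G)=\langle e_a,\ a\in\Gamma^G\mid e_ae_b=e_be_{a\triangleleft b},\ a,b\in\Gamma^G\rangle$. *)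

theory Defs
  imports "HOL-Algebra.Generated_Groups" "HOL-Algebra.Elementary_Groups" "HOL-Algebra.Bij"
begin

section \<open>Groups given by generators and relations\<close>

text \<open>The letter \<open>(x, True)\<close> stands for \<open>x\<close>, the letter \<open>(x, False)\<close> for the formal inverse of \<open>x\<close>.\<close>

type_synonym 'x word = "('x \<times> bool) list"

definition words :: "'x set \<Rightarrow> 'x word set" where
  "words X = lists (X \<times> UNIV)"

text \<open>A relation \<open>l = r\<close> is the pair \<open>(l, r)\<close>. Pairs that are not words over \<open>X\<close> are ignored.\<close>

inductive pres_eq :: "'x set \<Rightarrow> ('x word \<times> 'x word) set \<Rightarrow> 'x word \<Rightarrow> 'x word \<Rightarrow> bool"
  for X R where
  refl: "w \<in> words X \<Longrightarrow> pres_eq X R w w"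
| sym: "pres_eq X R v w \<Longrightarrow> pres_eq X R w v"
| trans: "pres_eq X R u v \<Longrightarrow> pres_eq X R v w \<Longrightarrow> pres_eq X R u w"
| cancel: "u \<in> words X \<Longrightarrow> v \<in> words X \<Longrightarrow> x \<in> X \<Longrightarrow>
    pres_eq X R (u @ [(x, b), (x, \<not> b)] @ v) (u @ v)"
| rel: "u \<in> words X \<Longrightarrow> v \<in> words X \<Longrightarrow> (l, r) \<in> R \<Longrightarrow> l \<in> words X \<Longrightarrow> r \<in> words X \<Longrightarrow>
    pres_eq X R (u @ l @ v) (u @ r @ v)"

definition pres_class :: "'x set \<Rightarrow> ('x word \<times> 'x word) set \<Rightarrow> 'x word \<Rightarrow> 'x word set" where
  "pres_class X R w = {v. pres_eq X R w v}"

definition presented_group :: "'x set \<Rightarrow> ('x word \<times> 'x word) set \<Rightarrow> 'x word set monoid" where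
  "presented_group X R =
    \<lparr>carrier = pres_class X R ` words X,
     monoid.mult = (\<lambda>A B. \<Union>u\<in>A. \<Union>v\<in>B. pres_class X R (u @ v)),
     one = pres_class X R []\<rparr>"

text \<open>\<open>\<langle>X | R\<rangle>\<close> is a presentation of \<open>G\<close>, where the generator \<open>x\<close> denotes the element \<open>\<iota> x\<close> of \<open>G\<close>.
  Distinct generators may denote the same element.\<close>

definition presentation_of ::
    "('g, 'm) monoid_scheme \<Rightarrow> 'x set \<Rightarrow> ('x word \<times> 'x word) set \<Rightarrow> ('x \<Rightarrow> 'g) \<Rightarrow> bool" where
  "presentation_of G X R \<iota> \<longleftrightarrow>
    R \<subseteq> words X \<times> words X \<and>
    (\<exists>h \<in> iso (presented_group X R) G. \<forall>x\<in>X. h (pres_class X R [(x, True)]) = \<iota> x)"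


section \<open>Presentations of type \<open>C\<close>-bar\<close>

definition conj_class :: "('g, 'm) monoid_scheme \<Rightarrow> 'g \<Rightarrow> 'g set" where
  "conj_class G x = {inv\<^bsub>G\<^esub> g \<otimes>\<^bsub>G\<^esub> x \<otimes>\<^bsub>G\<^esub> g | g. g \<in> carrier G}"

definition conj_relation :: "'x \<Rightarrow> 'x \<Rightarrow> 'x \<Rightarrow> 'x word \<times> 'x word" where
  "conj_relation a b c = ([(b, False), (a, True), (b, True)], [(c, True)])"

definition power_relation :: "'x \<Rightarrow> nat \<Rightarrow> 'x word \<times> 'x word" where
  "power_relation a k = (replicate k (a, True), [])"

definition cbar_presentation ::
    "('g, 'm) monoid_scheme \<Rightarrow> 'x set \<Rightarrow> ('x word \<times> 'x word) set \<Rightarrow> ('x \<Rightarrow> 'g) \<Rightarrow> bool" where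
  "cbar_presentation G X R \<iota> \<longleftrightarrow>
    presentation_of G X R \<iota> \<and>
    (\<forall>r\<in>R. (\<exists>a\<in>X. \<exists>b\<in>X. \<exists>c\<in>X. r = conj_relation a b c) \<or>
            (\<exists>a\<in>X. \<exists>k\<ge>2. r = power_relation a k)) \<and>
    (\<forall>g\<in>carrier G. \<exists>\<^sub>\<le>\<^sub>1 r. r \<in> R \<and>
            (\<exists>a\<in>X. \<exists>k\<ge>2. r = power_relation a k \<and> \<iota> a \<in> conj_class G g))"


section \<open>Dehn quandles and associated groups\<close>

definition dehn_quandle :: "('g, 'm) monoid_scheme \<Rightarrow> 'g set \<Rightarrow> 'g set" where
  "dehn_quandle G S = (\<Union>x\<in>S. conj_class G x)"

definition conj_op :: "('g, 'm) monoid_scheme \<Rightarrow> 'g \<Rightarrow> 'g \<Rightarrow> 'g" where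
  "conj_op G a b = inv\<^bsub>G\<^esub> b \<otimes>\<^bsub>G\<^esub> a \<otimes>\<^bsub>G\<^esub> b"

definition associated_group :: "'q set \<Rightarrow> ('q \<Rightarrow> 'q \<Rightarrow> 'q) \<Rightarrow> 'q word set monoid" where
  "associated_group Q f = presented_group Q
    {([(a, True), (b, True)], [(b, True), (f a b, True)]) | a b. a \<in> Q \<and> b \<in> Q}"


section \<open>Semidirect products\<close>

text \<open>To be used with \<open>\<phi> \<in> hom H (AutoGroup N)\<close>.\<close>

definition semidirect_product ::
    "('n, 'a) monoid_scheme \<Rightarrow> ('h, 'b) monoid_scheme \<Rightarrow> ('h \<Rightarrow> 'n \<Rightarrow> 'n) \<Rightarrow> ('n \<times> 'h) monoid" where
  "semidirect_product N H \<phi> =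
    \<lparr>carrier = carrier N \<times> carrier H,
     monoid.mult = (\<lambda>(n, h) (n', h'). (n \<otimes>\<^bsub>N\<^esub> \<phi> h n', h \<otimes>\<^bsub>H\<^esub> h')),
     one = (\<one>\<^bsub>N\<^esub>, \<one>\<^bsub>H\<^esub>)\<rparr>"

end

theory Submission
  imports Defs
begin

text \<open>Write \<open>A\<close> for the associated group of \<open>Q\<close>, the single conjugacy class containing all generators.
  There are homomorphisms \<open>p : A \<rightarrow> G\<close>, \<open>e_q \<mapsto> q\<close>, and \<open>d : A \<rightarrow> \<int>\<close>, \<open>e_q \<mapsto> 1\<close>, and the isomorphism is
  \<open>g \<mapsto> (p g \<cdot> a\<^bsup>-d g\<^esup>, d g)\<close>. The first component lies in \<open>G'\<close> because every \<open>q \<in> Q\<close> is congruent to \<open>a\<close>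
  modulo \<open>G'\<close>, and commutators lift along the surjection \<open>p\<close> to elements of degree 0.
  For injectivity one needs that \<open>d\<close> is injective on the kernel of \<open>p\<close>. This kernel is central, since
  conjugation of the \<open>e_q\<close> by \<open>g\<close> depends only on \<open>p g\<close>. The elements \<open>e_x\<close>, for \<open>x\<close> a generator of the presentation,
  generate \<open>A\<close> and satisfy its conjugation relations; the unique power relator \<open>x\<^bsup>k\<^esup>\<close>, if present,
  becomes the central element \<open>e_x\<^bsup>k\<^esup>\<close> of degree \<open>k \<noteq> 0\<close>. Hence the kernel is trivial or generated by \<open>e_x\<^bsup>k\<^esup>\<close>.\<close>

section \<open>Presented groups and evaluation of words\<close>

lemma words_simps [simp]:
  "[] \<in> words X"
  "l # w \<in> words X \<longleftrightarrow> fst l \<in> X \<and> w \<in> words X"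
  "u @ v \<in> words X \<longleftrightarrow> u \<in> words X \<and> v \<in> words X"
  by (cases l; auto simp: words_def)+

lemma pres_eq_words: "pres_eq X R u v \<Longrightarrow> u \<in> words X \<and> v \<in> words X"
  by (induction rule: pres_eq.induct) auto

text \<open>The rules \<open>cancel\<close> and \<open>rel\<close> already act inside arbitrary
  words, so the outer context is absorbed into their \<open>u\<close> and \<open>v\<close>.\<close>

lemma pres_eq_context:
  "pres_eq X R u v \<Longrightarrow> s \<in> words X \<Longrightarrow> t \<in> words X \<Longrightarrow> pres_eq X R (s @ u @ t) (s @ v @ t)"
proof (induction rule: pres_eq.induct)
  case (cancel u v x b)
  then show ?case
    using pres_eq.cancel[of "s @ u" X "v @ t" x R b] by simp
next
  case (rel u v l r)
  then show ?case
    using pres_eq.rel[of "s @ u" X "v @ t" l r R] by simp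
qed (auto intro: pres_eq.intros)

lemma pres_eq_append:
  assumes "pres_eq X R u u'" "pres_eq X R v v'"
  shows "pres_eq X R (u @ v) (u' @ v')"
proof -
  have "pres_eq X R (u @ v) (u' @ v)" "pres_eq X R (u' @ v) (u' @ v')"
    using pres_eq_context[OF assms(1), of "[]" v] pres_eq_context[OF assms(2), of u' "[]"]
      assms[THEN pres_eq_words] by auto
  then show ?thesis by (rule pres_eq.trans)
qed

text \<open>Only \<open>u\<close> has to be a word: reflexivity puts \<open>u\<close> into its own
  class, hence into that of \<open>v\<close>, while classes of non-words are empty.\<close>

lemma pres_class_eq_iff:
  "u \<in> words X \<Longrightarrow> pres_class X R u = pres_class X R v \<longleftrightarrow> pres_eq X R u v"
  unfolding pres_class_def by (blast intro: pres_eq.intros)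

definition word_inv :: "'x word \<Rightarrow> 'x word" where
  "word_inv w = rev (map (\<lambda>(x, b). (x, \<not> b)) w)"

lemma word_inv_simps [simp]:
  "word_inv [] = []"
  "word_inv ((x, b) # w) = word_inv w @ [(x, \<not> b)]"
  by (auto simp: word_inv_def)

lemma word_inv_in_words [simp]: "w \<in> words X \<Longrightarrow> word_inv w \<in> words X"
  by (induction w) auto

lemma pres_eq_word_inv: "w \<in> words X \<Longrightarrow> pres_eq X R (word_inv w @ w) []"
proof (induction w)
  case Nil
  then show ?case by (simp add: pres_eq.refl)
next
  case (Cons l w)
  obtain x b where l: "l = (x, b)" by fastforce
  \<comment> \<open>The innermost pair cancels; \<open>(x, b)\<close> is written with a double
    negation to fit the shape of the rule \<open>cancel\<close>.\<close>
  have "pres_eq X R (word_inv w @ [(x, \<not> b), (x, \<not> \<not> b)] @ w) (word_inv w @ w)"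
    using Cons.prems l by (intro pres_eq.cancel) auto
  with Cons l show ?case by (auto intro: pres_eq.trans)
qed

section \<open>Group structure on the classes of words\<close>

lemma carrier_presented_group: "carrier (presented_group X R) = pres_class X R ` words X"
  and one_presented_group: "\<one>\<^bsub>presented_group X R\<^esub> = pres_class X R []"
  by (auto simp: presented_group_def)

lemma pres_class_in_carrier [simp]:
  "w \<in> words X \<Longrightarrow> pres_class X R w \<in> carrier (presented_group X R)"
  by (simp add: carrier_presented_group)

text \<open>Congruence respects concatenation, so all terms of the union defining the product are
  the same class, and both index sets are nonempty.\<close>

lemma mult_presented_group:
  assumes "u \<in> words X" "v \<in> words X"
  shows "pres_class X R u \<otimes>\<^bsub>presented_group X R\<^esub> pres_class X R v = pres_class X R (u @ v)"
proof -
  have "pres_class X R (u' @ v') = pres_class X R (u @ v)"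
    if "u' \<in> pres_class X R u" "v' \<in> pres_class X R v" for u' v'
    using that assms pres_eq_append[of X R u u' v v']
    by (subst eq_commute) (auto simp: pres_class_eq_iff, auto simp: pres_class_def)
  moreover have "u \<in> pres_class X R u" "v \<in> pres_class X R v"
    using assms by (auto simp: pres_class_def intro: pres_eq.refl)
  ultimately have "(\<Union>u'\<in>pres_class X R u. \<Union>v'\<in>pres_class X R v. pres_class X R (u' @ v'))
      = pres_class X R (u @ v)"
    by blast
  then show ?thesis
    by (simp add: presented_group_def)
qed

lemma group_presented_group: "group (presented_group X R)"
proof (rule groupI)
  show "\<exists>y\<in>carrier (presented_group X R). y \<otimes>\<^bsub>presented_group X R\<^esub> x = \<one>\<^bsub>presented_group X R\<^esub>"
    if "x \<in> carrier (presented_group X R)" for x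
  proof -
    obtain w where w: "w \<in> words X" "x = pres_class X R w"
      using \<open>x \<in> _\<close> by (auto simp: carrier_presented_group)
    then have "pres_class X R (word_inv w) \<otimes>\<^bsub>presented_group X R\<^esub> x = \<one>\<^bsub>presented_group X R\<^esub>"
      by (simp add: mult_presented_group one_presented_group pres_class_eq_iff pres_eq_word_inv)
    with w show ?thesis by (meson pres_class_in_carrier word_inv_in_words)
  qed
qed (auto simp: carrier_presented_group one_presented_group mult_presented_group)

section \<open>Evaluation of words in a group\<close>

fun letter_eval :: "('g, 'm) monoid_scheme \<Rightarrow> ('x \<Rightarrow> 'g) \<Rightarrow> 'x \<times> bool \<Rightarrow> 'g" where
  "letter_eval H f (x, b) = (if b then f x else inv\<^bsub>H\<^esub> f x)"

primrec word_eval :: "('g, 'm) monoid_scheme \<Rightarrow> ('x \<Rightarrow> 'g) \<Rightarrow> 'x word \<Rightarrow> 'g" where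
  "word_eval H f [] = \<one>\<^bsub>H\<^esub>"
| "word_eval H f (l # w) = letter_eval H f l \<otimes>\<^bsub>H\<^esub> word_eval H f w"

lemma word_eval_cong:
  "w \<in> words X \<Longrightarrow> (\<And>x. x \<in> X \<Longrightarrow> f x = g x) \<Longrightarrow> word_eval H f w = word_eval H g w"
  by (induction w) auto

context group
begin

lemma letter_eval_in_subgroup: "subgroup B G \<Longrightarrow> f x \<in> B \<Longrightarrow> letter_eval G f (x, b) \<in> B"
  by (simp add: subgroup.m_inv_closed)

lemma word_eval_in_subgroup:
  assumes "subgroup B G" "\<And>x. x \<in> X \<Longrightarrow> f x \<in> B"
  shows "w \<in> words X \<Longrightarrow> word_eval G f w \<in> B"
proof (induction w)
  case (Cons l w)
  obtain x b where "l = (x, b)" by fastforce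
  with Cons letter_eval_in_subgroup[OF assms(1), of f x b] show ?case
    using assms by (simp add: subgroup.m_closed del: letter_eval.simps)
qed (use assms in \<open>simp add: subgroup.one_closed\<close>)

lemma letter_eval_closed: "(\<And>x. x \<in> X \<Longrightarrow> f x \<in> carrier G) \<Longrightarrow> fst l \<in> X \<Longrightarrow> letter_eval G f l \<in> carrier G"
  by (cases l) auto

lemma word_eval_closed:
  "(\<And>x. x \<in> X \<Longrightarrow> f x \<in> carrier G) \<Longrightarrow> w \<in> words X \<Longrightarrow> word_eval G f w \<in> carrier G"
  by (rule word_eval_in_subgroup[OF subgroup_self])

lemma word_eval_append:
  assumes "\<And>x. x \<in> X \<Longrightarrow> f x \<in> carrier G"
  shows "u \<in> words X \<Longrightarrow> v \<in> words X \<Longrightarrow> word_eval G f (u @ v) = word_eval G f u \<otimes> word_eval G f v"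
  by (induction u)
    (auto simp: m_assoc word_eval_closed[OF assms] letter_eval_closed[of X] assms simp del: letter_eval.simps)

lemma word_eval_word_inv:
  assumes f: "\<And>x. x \<in> X \<Longrightarrow> f x \<in> carrier G"
  shows "w \<in> words X \<Longrightarrow> word_eval G f (word_inv w) = inv (word_eval G f w)"
proof (induction w)
  case (Cons l w)
  obtain x b where "l = (x, b)" by fastforce
  with Cons f show ?case
    by (simp add: word_eval_append[where X = X] word_eval_closed[where X = X] inv_mult_group)
qed simp

lemma word_eval_replicate:
  "f x \<in> carrier G \<Longrightarrow> word_eval G f (replicate k (x, True)) = f x [^] k"
  by (induction k) (auto simp: nat_pow_Suc2[symmetric])

lemma subgroup_word_eval:
  assumes f: "\<And>x. x \<in> X \<Longrightarrow> f x \<in> carrier G"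
  shows "subgroup (word_eval G f ` words X) G"
proof (rule subgroupI)
  show "word_eval G f ` words X \<subseteq> carrier G" using word_eval_closed[OF f] by auto
  show "word_eval G f ` words X \<noteq> {}" using words_simps(1)[of X] by blast
  show "inv g \<in> word_eval G f ` words X" if "g \<in> word_eval G f ` words X" for g
    using that by (auto simp: word_eval_word_inv[OF f, symmetric])
  show "g \<otimes> h \<in> word_eval G f ` words X"
    if "g \<in> word_eval G f ` words X" "h \<in> word_eval G f ` words X" for g h
    using that by (auto simp: word_eval_append[OF f, symmetric])
qed

text \<open>Relations may fail in \<open>G\<close> by a defect from the central subgroup
  \<open>T\<close>. A defect arising inside a word moves to its front by centrality, and defects
  multiply within \<open>T\<close> along a derivation. Trivial \<open>T\<close> yields the universal
  property of presentations; the powers of a power relator yield the kernel of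
  \<open>As_proj\<close>.\<close>

lemma pres_eq_word_eval_mod_central:
  assumes f: "\<And>x. x \<in> X \<Longrightarrow> f x \<in> carrier G"
    and T: "subgroup T G"
    and central: "\<And>t g. t \<in> T \<Longrightarrow> g \<in> carrier G \<Longrightarrow> t \<otimes> g = g \<otimes> t"
    and rels: "\<And>l r. (l, r) \<in> R \<Longrightarrow> l \<in> words X \<Longrightarrow> r \<in> words X \<Longrightarrow>
      \<exists>t\<in>T. word_eval G f l = t \<otimes> word_eval G f r"
  shows "pres_eq X R u v \<Longrightarrow> \<exists>t\<in>T. word_eval G f u = t \<otimes> word_eval G f v"
proof (induction rule: pres_eq.induct)
  case (refl w)
  then show ?case
    using subgroup.one_closed[OF T] word_eval_closed[OF f refl] by force
next
  case (sym v w)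
  then obtain t where t: "t \<in> T" "word_eval G f v = t \<otimes> word_eval G f w" by blast
  have "w \<in> words X" using sym pres_eq_words by blast
  then have "word_eval G f w = inv t \<otimes> word_eval G f v"
    using t T f by (simp add: inv_solve_left subgroup.mem_carrier word_eval_closed[OF f])
  with t T show ?case by (meson subgroup.m_inv_closed)
next
  case (trans u v w)
  then obtain s t where st: "s \<in> T" "t \<in> T" "word_eval G f u = s \<otimes> word_eval G f v"
    "word_eval G f v = t \<otimes> word_eval G f w" by blast
  have "w \<in> words X" using trans pres_eq_words by blast
  then have "word_eval G f u = (s \<otimes> t) \<otimes> word_eval G f w"
    using st T by (simp add: m_assoc subgroup.mem_carrier word_eval_closed[OF f])
  with st T show ?case by (meson subgroup.m_closed)
next
  case (cancel u v x b)
  have "word_eval G f (u @ [(x, b), (x, \<not> b)] @ v) = word_eval G f (u @ v)"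
    using cancel f
    by (cases b) (simp_all add: word_eval_append[OF f] word_eval_closed[OF f] m_assoc[symmetric])
  moreover have "word_eval G f (u @ v) \<in> carrier G"
    using cancel by (simp add: word_eval_closed[OF f])
  ultimately show ?case
    using subgroup.one_closed[OF T] by (intro bexI[of _ "\<one>"]) simp_all
next
  case (rel u v l r)
  then obtain t where t: "t \<in> T" "word_eval G f l = t \<otimes> word_eval G f r"
    using rels by blast
  have [simp]: "t \<in> carrier G" using t T by (simp add: subgroup.mem_carrier)
  have "word_eval G f u \<otimes> t = t \<otimes> word_eval G f u"
    using central[OF t(1)] rel(1) by (simp add: word_eval_closed[OF f])
  then have "word_eval G f (u @ l @ v) = t \<otimes> word_eval G f (u @ r @ v)"
    using rel t by (simp add: word_eval_append[OF f] word_eval_closed[OF f] m_assoc[symmetric])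
  with t show ?case by blast
qed

end

section \<open>Generation of presented groups and homomorphisms out of them\<close>

lemma hom_word_eval:
  assumes "group K" "group H" "h \<in> hom K H" and f: "\<And>x. x \<in> X \<Longrightarrow> f x \<in> carrier K"
  shows "w \<in> words X \<Longrightarrow> h (word_eval K f w) = word_eval H (\<lambda>x. h (f x)) w"
proof (induction w)
  interpret group_hom K H h using assms by (simp add: group_hom_def group_hom_axioms_def)
  {
    case Nil
    then show ?case by simp
  next
    case (Cons l w)
    then show ?case
      using G.word_eval_closed[of X f w, OF f] by (cases l) (auto simp: f)
  }
qed

lemma pres_class_inv_letter:
  assumes "x \<in> X"
  shows "pres_class X R [(x, False)] = inv\<^bsub>presented_group X R\<^esub> pres_class X R [(x, True)]"
proof -
  interpret group "presented_group X R" by (rule group_presented_group)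
  show ?thesis
    using assms pres_eq_word_inv[of "[(x, True)]" X R]
    by (intro inv_equality[symmetric])
      (auto simp: mult_presented_group one_presented_group pres_class_eq_iff)
qed

lemma pres_class_eq_word_eval:
  "w \<in> words X \<Longrightarrow>
    pres_class X R w = word_eval (presented_group X R) (\<lambda>x. pres_class X R [(x, True)]) w"
proof (induction w)
  case (Cons l w)
  obtain x b where l: "l = (x, b)" by fastforce
  have "pres_class X R (l # w) = pres_class X R [l] \<otimes>\<^bsub>presented_group X R\<^esub> pres_class X R w"
    using Cons.prems by (simp add: mult_presented_group)
  with Cons l show ?case by (cases b) (simp_all add: pres_class_inv_letter)
qed (simp add: one_presented_group)

text \<open>Every class is the value of its own word at the generator classes. In this form,
  induction over generators amounts to checking that a set is a subgroup.\<close>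

lemma presented_group_generated:
  assumes "subgroup B (presented_group X R)" "\<And>x. x \<in> X \<Longrightarrow> pres_class X R [(x, True)] \<in> B"
    and "g \<in> carrier (presented_group X R)"
  shows "g \<in> B"
proof -
  obtain w where w: "w \<in> words X" "g = pres_class X R w"
    using assms(3) by (auto simp: carrier_presented_group)
  have "word_eval (presented_group X R) (\<lambda>x. pres_class X R [(x, True)]) w \<in> B"
    using assms(2) w(1) by (rule group.word_eval_in_subgroup[OF group_presented_group assms(1)])
  then show ?thesis
    using w pres_class_eq_word_eval by metis
qed

text \<open>The existence half of the universal property: evaluation is constant on classes, so it
  can be read off any representative.\<close>

lemma presented_group_hom_exists:
  assumes "group H" and f: "\<And>x. x \<in> X \<Longrightarrow> f x \<in> carrier H"
    and rels: "\<And>l r. (l, r) \<in> R \<Longrightarrow> l \<in> words X \<Longrightarrow> r \<in> words X \<Longrightarrow> word_eval H f l = word_eval H f r"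
  shows "\<exists>h\<in>hom (presented_group X R) H. \<forall>x\<in>X. h (pres_class X R [(x, True)]) = f x"
proof (intro bexI ballI)
  interpret group H by fact
  \<comment> \<open>With \<open>T\<close> trivial there are no defects, and the values agree
    exactly.\<close>
  have eq: "word_eval H f u = word_eval H f v" if "pres_eq X R u v" for u v
    using pres_eq_word_eval_mod_central[of X f "{\<one>\<^bsub>H\<^esub>}" R, OF f triv_subgroup _ _ that]
      rels pres_eq_words[OF that] by (auto simp: word_eval_closed[OF f])
  define h where "h C = word_eval H f (SOME w. w \<in> C)" for C
  have h: "h (pres_class X R w) = word_eval H f w" if "w \<in> words X" for w
  proof -
    have "w \<in> pres_class X R w" using that by (simp add: pres_class_def pres_eq.refl)
    then have "(SOME v. v \<in> pres_class X R w) \<in> pres_class X R w" by (rule someI)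
    then show ?thesis using eq by (auto simp: h_def pres_class_def)
  qed
  show "h \<in> hom (presented_group X R) H"
    by (rule homI)
      (auto simp: carrier_presented_group h mult_presented_group word_eval_closed[OF f] word_eval_append[OF f])
  show "h (pres_class X R [(x, True)]) = f x" if "x \<in> X" for x
    using that f by (simp add: h)
qed

section \<open>The associated group of a conjugation-closed subset\<close>

text \<open>Supplies closure under inverses for sets of elements defined by a commutation
  equation.\<close>

lemma (in group) mult_inv_swap:
  assumes "y \<otimes> g = g \<otimes> x" "g \<in> carrier G" "x \<in> carrier G" "y \<in> carrier G"
  shows "x \<otimes> inv g = inv g \<otimes> y"
proof -
  have "x = inv g \<otimes> (y \<otimes> g)"
    using assms by (simp add: m_assoc[symmetric])
  then show ?thesis using assms(2,4) by (simp add: m_assoc)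
qed

text \<open>Closure under conjugation keeps \<open>conj_op G a b\<close> in the alphabet
  \<open>Q\<close>, so no defining relation of the associated group is ignored as a
  non-word.\<close>

locale conj_closed_subset = group G for G (structure) +
  fixes Q
  assumes Q_subset: "Q \<subseteq> carrier G"
    and Q_conj: "\<And>q g. q \<in> Q \<Longrightarrow> g \<in> carrier G \<Longrightarrow> inv g \<otimes> q \<otimes> g \<in> Q"
begin

abbreviation As where "As \<equiv> associated_group Q (conj_op G)"

definition As_rels where
  "As_rels = {([(a, True), (b, True)], [(b, True), (conj_op G a b, True)]) | a b. a \<in> Q \<and> b \<in> Q}"

lemma As_eq: "As = presented_group Q As_rels"
  by (simp add: associated_group_def As_rels_def)

definition As_gen where
  "As_gen q = pres_class Q As_rels [(q, True)]"

definition As_proj where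
  "As_proj = (SOME p. p \<in> hom As G \<and> (\<forall>q\<in>Q. p (As_gen q) = q))"

definition As_degree where
  "As_degree = (SOME d. d \<in> hom As integer_group \<and> (\<forall>q\<in>Q. d (As_gen q) = 1))"

lemma Q_closed [simp]: "q \<in> Q \<Longrightarrow> q \<in> carrier G"
  using Q_subset by blast

lemma conj_op_in_Q: "a \<in> Q \<Longrightarrow> b \<in> Q \<Longrightarrow> conj_op G a b \<in> Q"
  by (simp add: conj_op_def Q_conj)

lemma As_gen_closed [simp]: "q \<in> Q \<Longrightarrow> As_gen q \<in> carrier As"
  by (simp add: As_gen_def As_eq)

text \<open>In \<open>G\<close> the defining relation is the identity
  \<open>a b = b (inv b a b)\<close>.\<close>

lemma As_proj_props: "As_proj \<in> hom As G \<and> (\<forall>q\<in>Q. As_proj (As_gen q) = q)"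
proof -
  have "word_eval G (\<lambda>q. q) l = word_eval G (\<lambda>q. q) r" if "(l, r) \<in> As_rels" for l r
    using that by (auto simp: As_rels_def conj_op_def m_assoc[symmetric])
  then have "\<exists>p\<in>hom As G. \<forall>q\<in>Q. p (As_gen q) = q"
    unfolding As_eq As_gen_def by (intro presented_group_hom_exists is_group) auto
  then show ?thesis
    unfolding As_proj_def Bex_def by (rule someI_ex)
qed

text \<open>Both sides of every defining relation have two positive letters, so the signed count of
  letters respects the relations.\<close>

lemma As_degree_props: "As_degree \<in> hom As integer_group \<and> (\<forall>q\<in>Q. As_degree (As_gen q) = 1)"
proof -
  have "word_eval integer_group (\<lambda>_. 1) l = word_eval integer_group (\<lambda>_. 1) r"
    if "(l, r) \<in> As_rels" for l r
    using that by (auto simp: As_rels_def)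
  then have "\<exists>d\<in>hom As integer_group. \<forall>q\<in>Q. d (As_gen q) = 1"
    unfolding As_eq As_gen_def by (intro presented_group_hom_exists group_integer_group) auto
  then show ?thesis
    unfolding As_degree_def Bex_def by (rule someI_ex)
qed

sublocale As: group As
  unfolding As_eq by (rule group_presented_group)

sublocale As_proj: group_hom As G As_proj
  using As_proj_props by unfold_locales blast

sublocale As_degree: group_hom As integer_group As_degree
  using As_degree_props
  by (intro group_hom.intro group_hom_axioms.intro As.is_group group_integer_group) blast

lemma As_proj_gen [simp]: "q \<in> Q \<Longrightarrow> As_proj (As_gen q) = q"
  using As_proj_props by blast

lemma As_degree_gen [simp]: "q \<in> Q \<Longrightarrow> As_degree (As_gen q) = 1"
  using As_degree_props by blast

lemma As_generated:
  assumes "subgroup B As" "\<And>q. q \<in> Q \<Longrightarrow> As_gen q \<in> B" "g \<in> carrier As"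
  shows "g \<in> B"
  using assms unfolding As_gen_def As_eq by (rule presented_group_generated)

lemma As_gen_mult:
  assumes "a \<in> Q" "b \<in> Q"
  shows "As_gen a \<otimes>\<^bsub>As\<^esub> As_gen b = As_gen b \<otimes>\<^bsub>As\<^esub> As_gen (conj_op G a b)"
  using assms pres_eq.rel[of "[]" Q "[]" "[(a, True), (b, True)]" "[(b, True), (conj_op G a b, True)]" As_rels]
  by (auto simp: As_gen_def As_eq As_rels_def mult_presented_group pres_class_eq_iff conj_op_in_Q)

text \<open>For \<open>g\<close> a generator this is a defining relation, and the elements
  satisfying it for all \<open>q\<close> at once form a subgroup. The quantifier over
  \<open>q\<close> sits inside the set because products and inverses pass to conjugates of
  \<open>q\<close>.\<close>

lemma As_gen_conj:
  assumes "g \<in> carrier As" "q \<in> Q"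
  shows "As_gen q \<otimes>\<^bsub>As\<^esub> g = g \<otimes>\<^bsub>As\<^esub> As_gen (inv (As_proj g) \<otimes> q \<otimes> As_proj g)"
proof -
  let ?c = "\<lambda>g q. inv (As_proj g) \<otimes> q \<otimes> As_proj g"
  let ?B = "{g \<in> carrier As. \<forall>q\<in>Q. As_gen q \<otimes>\<^bsub>As\<^esub> g = g \<otimes>\<^bsub>As\<^esub> As_gen (?c g q)}"
  have cQ: "?c g q \<in> Q" if "g \<in> carrier As" "q \<in> Q" for g q
    using that by (simp add: Q_conj)
  have "subgroup ?B As"
  proof (rule As.subgroupI)
    show "?B \<subseteq> carrier As" by blast
    have "\<one>\<^bsub>As\<^esub> \<in> ?B" by auto
    then show "?B \<noteq> {}" by blast
  next
    fix g assume g: "g \<in> ?B"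
    have "As_gen q \<otimes>\<^bsub>As\<^esub> inv\<^bsub>As\<^esub> g = inv\<^bsub>As\<^esub> g \<otimes>\<^bsub>As\<^esub> As_gen (?c (inv\<^bsub>As\<^esub> g) q)"
      if q: "q \<in> Q" for q
    proof -
      \<comment> \<open>The equation for \<open>g\<close> is used at \<open>?r\<close>, the
        conjugate that \<open>As_proj g\<close> carries back to \<open>q\<close>, and is then turned
        around.\<close>
      let ?r = "?c (inv\<^bsub>As\<^esub> g) q"
      have r: "?r \<in> Q" using g q by (intro cQ) auto
      have "As_gen ?r \<otimes>\<^bsub>As\<^esub> g = g \<otimes>\<^bsub>As\<^esub> As_gen (?c g ?r)"
        using g r by blast
      also have "?c g ?r = q"
        using g q by (simp add: m_assoc inv_solve_left')
      finally show ?thesis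
        using g q r by (intro As.mult_inv_swap) auto
    qed
    with g show "inv\<^bsub>As\<^esub> g \<in> ?B" by blast
  next
    fix g h assume gh: "g \<in> ?B" "h \<in> ?B"
    have "As_gen q \<otimes>\<^bsub>As\<^esub> (g \<otimes>\<^bsub>As\<^esub> h) = (g \<otimes>\<^bsub>As\<^esub> h) \<otimes>\<^bsub>As\<^esub> As_gen (?c (g \<otimes>\<^bsub>As\<^esub> h) q)"
      if q: "q \<in> Q" for q
    proof -
      have gh': "g \<in> carrier As" "h \<in> carrier As" using gh by auto
      have c: "?c (g \<otimes>\<^bsub>As\<^esub> h) q = ?c h (?c g q)"
        using gh' q by (simp add: inv_mult_group m_assoc)
      have q1: "?c g q \<in> Q" and q2: "?c h (?c g q) \<in> Q" using gh' q cQ by auto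
      have "As_gen q \<otimes>\<^bsub>As\<^esub> (g \<otimes>\<^bsub>As\<^esub> h) = (As_gen q \<otimes>\<^bsub>As\<^esub> g) \<otimes>\<^bsub>As\<^esub> h"
        using gh' q by (simp add: As.m_assoc)
      also have "\<dots> = g \<otimes>\<^bsub>As\<^esub> (As_gen (?c g q) \<otimes>\<^bsub>As\<^esub> h)"
        using gh gh' q q1 by (simp add: As.m_assoc)
      also have "As_gen (?c g q) \<otimes>\<^bsub>As\<^esub> h = h \<otimes>\<^bsub>As\<^esub> As_gen (?c h (?c g q))"
        using gh q1 by blast
      finally show ?thesis
        unfolding c using gh' q2 by (simp add: As.m_assoc)
    qed
    with gh show "g \<otimes>\<^bsub>As\<^esub> h \<in> ?B" by blast
  qed
  moreover have "As_gen r \<in> ?B" if "r \<in> Q" for r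
    using that As_gen_mult[of _ r] by (auto simp: conj_op_def)
  ultimately show ?thesis
    using As_generated[of ?B g] assms by blast
qed

text \<open>By \<open>As_gen_conj\<close>, conjugation by \<open>z\<close> moves
  \<open>As_gen q\<close> only as \<open>As_proj z\<close> moves \<open>q\<close>, that is, not at
  all; commuting with the generators suffices.\<close>

lemma As_proj_kernel_central:
  assumes z: "z \<in> carrier As" "As_proj z = \<one>" and g: "g \<in> carrier As"
  shows "z \<otimes>\<^bsub>As\<^esub> g = g \<otimes>\<^bsub>As\<^esub> z"
proof -
  let ?B = "{g \<in> carrier As. z \<otimes>\<^bsub>As\<^esub> g = g \<otimes>\<^bsub>As\<^esub> z}"
  have "subgroup ?B As"
  proof (rule As.subgroupI)
    have "\<one>\<^bsub>As\<^esub> \<in> ?B" using z by auto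
    then show "?B \<noteq> {}" by blast
    show "inv\<^bsub>As\<^esub> g \<in> ?B" if "g \<in> ?B" for g
      using that z As.mult_inv_swap[of z g z] by auto
    show "g \<otimes>\<^bsub>As\<^esub> h \<in> ?B" if "g \<in> ?B" "h \<in> ?B" for g h
      using that z by simp (metis As.m_assoc)
  qed auto
  moreover have "As_gen q \<in> ?B" if "q \<in> Q" for q
    using that z As_gen_conj[of z q] by simp
  ultimately show ?thesis
    using As_generated[of ?B g] g by blast
qed

text \<open>An arbitrary \<open>q\<close> is a conjugate of some \<open>\<iota> x\<close> by some
  \<open>g\<close>. A word for \<open>g\<close>, evaluated in \<open>As\<close>, lifts
  \<open>g\<close>, and conjugating \<open>As_gen (\<iota> x)\<close> by this lift gives
  \<open>As_gen q\<close>.\<close>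

lemma As_word_eval_surj:
  assumes \<iota>: "\<And>x. x \<in> X \<Longrightarrow> \<iota> x \<in> Q"
    and conj: "\<And>q. q \<in> Q \<Longrightarrow> \<exists>x\<in>X. q \<in> conj_class G (\<iota> x)"
    and gen: "word_eval G \<iota> ` words X = carrier G"
  shows "word_eval As (\<lambda>x. As_gen (\<iota> x)) ` words X = carrier As"
proof -
  let ?ev = "word_eval As (\<lambda>x. As_gen (\<iota> x))"
  let ?B = "?ev ` words X"
  have B: "subgroup ?B As"
    using \<iota> by (intro As.subgroup_word_eval) auto
  have "As_gen q \<in> ?B" if q: "q \<in> Q" for q
  proof -
    obtain x g where x: "x \<in> X" and g: "g \<in> carrier G" "q = inv g \<otimes> \<iota> x \<otimes> g"
      using conj[OF q] by (auto simp: conj_class_def)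
    then obtain w where w: "w \<in> words X" "g = word_eval G \<iota> w"
      using gen by blast
    have ev: "?ev w \<in> carrier As"
      using w \<iota> by (intro As.word_eval_closed[of X]) auto
    have "As_proj (?ev w) = word_eval G (\<lambda>x. As_proj (As_gen (\<iota> x))) w"
      using w \<iota> by (intro hom_word_eval[of _ _ _ X]) auto
    also have "\<dots> = g"
      using w \<iota> by (auto intro!: word_eval_cong[of _ X])
    finally have "As_gen (\<iota> x) \<otimes>\<^bsub>As\<^esub> ?ev w = ?ev w \<otimes>\<^bsub>As\<^esub> As_gen q"
      using As_gen_conj[OF ev \<iota>[OF x]] g by simp
    then have "As_gen q = inv\<^bsub>As\<^esub> (?ev w) \<otimes>\<^bsub>As\<^esub> (As_gen (\<iota> x) \<otimes>\<^bsub>As\<^esub> ?ev w)"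
      using ev q x \<iota> by (simp add: As.inv_solve_left)
    moreover have "As_gen (\<iota> x) \<in> ?B"
    proof (rule image_eqI)
      show "As_gen (\<iota> x) = ?ev [(x, True)]" using x \<iota> by simp
    qed (use x in simp)
    ultimately show ?thesis
      using B w by (simp add: subgroup.m_closed subgroup.m_inv_closed)
  qed
  then show ?thesis
    using As_generated[OF B] subgroup.subset[OF B] by blast
qed

end

section \<open>The kernel of the projection\<close>

text \<open>The given isomorphism sends each class to the value of its word, so its surjectivity and
  injectivity become statements about \<open>word_eval\<close>.\<close>

lemma presentation_of_word_eval:
  assumes "group G" "presentation_of G X R \<iota>"
  shows "x \<in> X \<Longrightarrow> \<iota> x \<in> carrier G"
    and "word_eval G \<iota> ` words X = carrier G"
    and "u \<in> words X \<Longrightarrow> v \<in> words X \<Longrightarrow> word_eval G \<iota> u = word_eval G \<iota> v \<longleftrightarrow> pres_eq X R u v"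
proof -
  obtain h where h: "h \<in> iso (presented_group X R) G"
    and h_gen: "\<And>x. x \<in> X \<Longrightarrow> h (pres_class X R [(x, True)]) = \<iota> x"
    using assms by (auto simp: presentation_of_def)
  have hom: "h \<in> hom (presented_group X R) G"
    and img: "h ` carrier (presented_group X R) = carrier G"
    and inj: "inj_on h (carrier (presented_group X R))"
    using h by (auto simp: iso_iff)
  have ev: "h (pres_class X R w) = word_eval G \<iota> w" if w: "w \<in> words X" for w
  proof -
    have "h (pres_class X R w)
        = h (word_eval (presented_group X R) (\<lambda>x. pres_class X R [(x, True)]) w)"
      using pres_class_eq_word_eval[OF w] by (rule arg_cong)
    also have "\<dots> = word_eval G (\<lambda>x. h (pres_class X R [(x, True)])) w"
      using w by (intro hom_word_eval[OF group_presented_group assms(1) hom]) auto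
    also have "\<dots> = word_eval G \<iota> w"
      using w h_gen by (rule word_eval_cong)
    finally show ?thesis .
  qed
  show "\<iota> x \<in> carrier G" if "x \<in> X"
    using that h_gen[OF that] hom_in_carrier[OF hom, of "pres_class X R [(x, True)]"] by simp
  show "word_eval G \<iota> ` words X = carrier G"
    using img by (simp add: carrier_presented_group image_image ev)
  show "word_eval G \<iota> u = word_eval G \<iota> v \<longleftrightarrow> pres_eq X R u v"
    if "u \<in> words X" "v \<in> words X"
    using that inj by (simp add: ev[symmetric] inj_on_eq_iff pres_class_eq_iff)
qed

lemma (in group) subgroup_int_powers:
  assumes "t \<in> carrier G"
  shows "subgroup (range (\<lambda>i::int. t [^] i)) G"
  using assms
  by (intro subgroupI) (auto simp: int_pow_mult[symmetric] int_pow_neg[symmetric])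

context conj_closed_subset
begin

text \<open>A word for \<open>g\<close> has value one in \<open>G\<close>, so the relations reduce
  it to the empty word. Carrying out this reduction in \<open>As\<close> costs only defects from the
  power relation, and these are detected by the degree.\<close>

lemma As_proj_degree_kernel_trivial:
  assumes cbar: "cbar_presentation G X R \<iota>"
    and a: "a \<in> X" and Q: "Q = conj_class G (\<iota> a)" and \<iota>Q: "\<And>x. x \<in> X \<Longrightarrow> \<iota> x \<in> Q"
    and g: "g \<in> carrier As" "As_proj g = \<one>" "As_degree g = 0"
  shows "g = \<one>\<^bsub>As\<^esub>"
proof -
  have pres: "presentation_of G X R \<iota>"
    and R_words: "R \<subseteq> words X \<times> words X"
    and R_cases: "\<And>r. r \<in> R \<Longrightarrow> (\<exists>a\<in>X. \<exists>b\<in>X. \<exists>c\<in>X. r = conj_relation a b c) \<or>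
            (\<exists>a\<in>X. \<exists>k\<ge>2. r = power_relation a k)"
    using cbar by (auto simp: cbar_presentation_def presentation_of_def)
  \<comment> \<open>The instance for the class of \<open>\<iota> a\<close>: every generator lies in
    it, so \<open>R\<close> has at most one power relation in total.\<close>
  have "\<exists>\<^sub>\<le>\<^sub>1 r. r \<in> R \<and> (\<exists>x\<in>X. \<exists>k\<ge>2. r = power_relation x k \<and> \<iota> x \<in> conj_class G (\<iota> a))"
    using cbar \<iota>Q[OF a] by (simp add: cbar_presentation_def)
  then have power_unique: "r = s"
    if "r \<in> R" "s \<in> R" "\<exists>x\<in>X. \<exists>k\<ge>2. r = power_relation x k" "\<exists>x\<in>X. \<exists>k\<ge>2. s = power_relation x k" for r s
    using that \<iota>Q unfolding Uniq_def Q by blast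
  note ev_iff = presentation_of_word_eval(3)[OF is_group pres]
  let ?F = "\<lambda>x. As_gen (\<iota> x)"
  let ?ev = "word_eval As ?F"
  have F: "?F x \<in> carrier As" if "x \<in> X" for x
    using that \<iota>Q by simp
  have proj_ev: "As_proj (?ev w) = word_eval G \<iota> w" if "w \<in> words X" for w
  proof -
    have "As_proj (?ev w) = word_eval G (\<lambda>x. As_proj (?F x)) w"
      using that F by (intro hom_word_eval[OF As.is_group is_group As_proj.homh])
    also have "\<dots> = word_eval G \<iota> w"
      using that \<iota>Q by (intro word_eval_cong) auto
    finally show ?thesis .
  qed
  have rel_eq: "word_eval G \<iota> l = word_eval G \<iota> r" if "(l, r) \<in> R" for l r
  proof -
    have "l \<in> words X" "r \<in> words X" using that R_words by auto
    then show ?thesis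
      using pres_eq.rel[of "[]" X "[]" l r R] that by (simp add: ev_iff)
  qed
  \<comment> \<open>\<open>T\<close> is to hold the values in \<open>As\<close> of the power
    relators. Its elements die in \<open>G\<close>, hence are central, and the degree is injective
    on it.\<close>
  obtain T where T: "subgroup T As"
    and T_proj: "\<And>t. t \<in> T \<Longrightarrow> As_proj t = \<one>"
    and T_degree: "\<And>t. t \<in> T \<Longrightarrow> As_degree t = 0 \<Longrightarrow> t = \<one>\<^bsub>As\<^esub>"
    and T_power: "\<And>x k. x \<in> X \<Longrightarrow> k \<ge> 2 \<Longrightarrow> power_relation x k \<in> R \<Longrightarrow> ?F x [^]\<^bsub>As\<^esub> k \<in> T"
  proof (cases "\<exists>x\<in>X. \<exists>k\<ge>2. power_relation x k \<in> R")
    case False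
    with that[of "{\<one>\<^bsub>As\<^esub>}"] show ?thesis
      using As.triv_subgroup by auto
  next
    case True
    then obtain x k where x: "x \<in> X" and k: "k \<ge> 2" and xk: "power_relation x k \<in> R" by blast
    let ?t = "?F x [^]\<^bsub>As\<^esub> k"
    have t: "?t \<in> carrier As" using F[OF x] by simp
    have "As_proj ?t = \<iota> x [^] k"
      using F[OF x] \<iota>Q[OF x] by (simp add: As_proj.hom_nat_pow)
    also have "\<dots> = \<one>"
      using rel_eq[of "replicate k (x, True)" "[]"] xk \<iota>Q[OF x]
      by (simp add: power_relation_def word_eval_replicate)
    finally have t_proj: "As_proj ?t = \<one>" .
    have t_deg: "As_degree ?t = int k"
      using F[OF x] \<iota>Q[OF x] by (simp add: As_degree.hom_nat_pow)
    show ?thesis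
    proof (rule that[of "range (\<lambda>i::int. ?t [^]\<^bsub>As\<^esub> i)"])
      show "subgroup (range (\<lambda>i::int. ?t [^]\<^bsub>As\<^esub> i)) As"
        using t by (rule As.subgroup_int_powers)
      show "As_proj s = \<one>" if "s \<in> range (\<lambda>i::int. ?t [^]\<^bsub>As\<^esub> i)" for s
        using that t t_proj by (auto simp: As_proj.hom_int_pow)
      show "s = \<one>\<^bsub>As\<^esub>" if s: "s \<in> range (\<lambda>i::int. ?t [^]\<^bsub>As\<^esub> i)" "As_degree s = 0" for s
      proof -
        obtain i :: int where i: "s = ?t [^]\<^bsub>As\<^esub> i" using s(1) by blast
        have "As_degree s = i * int k"
          unfolding i using As_degree.hom_int_pow[OF t, of i] t_deg by simp
        \<comment> \<open>Since \<open>k \<ge> 2\<close>, the degree of \<open>?t\<close> is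
          nonzero.\<close>
        with s(2) k have "i = 0" by simp
        with i show ?thesis by simp
      qed
      show "?F y [^]\<^bsub>As\<^esub> m \<in> range (\<lambda>i::int. ?t [^]\<^bsub>As\<^esub> i)"
        if "y \<in> X" "m \<ge> 2" "power_relation y m \<in> R" for y m
      proof -
        have "power_relation y m = power_relation x k"
          using power_unique[of "power_relation y m" "power_relation x k"] that x k xk by blast
        \<comment> \<open>A nonempty relator \<open>replicate k (x, True)\<close> determines its
          letter and its length.\<close>
        then have "y = x" "m = k"
          using k by (auto simp: power_relation_def)
        then have "?F y [^]\<^bsub>As\<^esub> m = ?t [^]\<^bsub>As\<^esub> (1::int)"
          using t by simp
        then show ?thesis by blast
      qed
    qed
  qed
  have central: "t \<otimes>\<^bsub>As\<^esub> h = h \<otimes>\<^bsub>As\<^esub> t" if "t \<in> T" "h \<in> carrier As" for t h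
    using that T T_proj by (intro As_proj_kernel_central) (auto simp: subgroup.mem_carrier)
  have rels: "\<exists>t\<in>T. ?ev l = t \<otimes>\<^bsub>As\<^esub> ?ev r" if lr: "(l, r) \<in> R" for l r
    using R_cases[OF lr]
  proof (elim disjE bexE exE conjE)
    fix x y z assume X: "x \<in> X" "y \<in> X" "z \<in> X" and "(l, r) = conj_relation x y z"
    then have l: "l = [(y, False), (x, True), (y, True)]" and r: "r = [(z, True)]"
      by (auto simp: conj_relation_def)
    \<comment> \<open>Conjugation relations lift without defect: holding in \<open>G\<close>, they
      identify \<open>\<iota> z\<close> as the conjugate that occurs in a defining relation of
      \<open>As\<close>.\<close>
    have "conj_op G (\<iota> x) (\<iota> y) = \<iota> z"
      using rel_eq[OF lr] X \<iota>Q by (simp add: l r conj_op_def m_assoc)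
    then have "?F x \<otimes>\<^bsub>As\<^esub> ?F y = ?F y \<otimes>\<^bsub>As\<^esub> ?F z"
      using As_gen_mult[of "\<iota> x" "\<iota> y"] X \<iota>Q by simp
    then have "?ev l = ?ev r"
      using X F by (simp add: l r As.m_assoc[symmetric] As.inv_solve_left')
    then show ?thesis
      using subgroup.one_closed[OF T] F X r by force
  next
    fix x and k :: nat assume x: "x \<in> X" and k: "2 \<le> k" and "(l, r) = power_relation x k"
    \<comment> \<open>Here the defect is the value of the relator itself.\<close>
    with T_power[OF x k] lr F[OF x] show ?thesis
      by (intro bexI[of _ "?F x [^]\<^bsub>As\<^esub> k"]) (auto simp: power_relation_def As.word_eval_replicate)
  qed
  have "word_eval As ?F ` words X = carrier As"
    using \<iota>Q a Q presentation_of_word_eval(2)[OF is_group pres] by (intro As_word_eval_surj) auto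
  then obtain w where w: "w \<in> words X" "g = ?ev w"
    using g(1) by blast
  then have "pres_eq X R w []"
    using g(2) proj_ev[of w] ev_iff[of w "[]"] by simp
  then have "\<exists>t\<in>T. ?ev w = t \<otimes>\<^bsub>As\<^esub> ?ev []"
    using As.pres_eq_word_eval_mod_central[OF F T central rels] by blast
  \<comment> \<open>The empty word has value one, so the accumulated defect is
    \<open>g\<close>.\<close>
  then have "g \<in> T"
    using w T by (auto simp: subgroup.mem_carrier)
  then show ?thesis
    using T_degree g(3) by blast
qed

end

section \<open>The semidirect product decomposition\<close>

text \<open>Conjugation is restricted to \<open>N\<close> because members of
  \<open>AutoGroup\<close> are extensional functions. Exponents add under composition, so the map at
  \<open>- i\<close> inverts the one at \<open>i\<close>.\<close>

lemma (in group) conj_power_hom_AutoGroup: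
  assumes N: "N \<lhd> G" and c: "c \<in> carrier G"
  shows "(\<lambda>i::int. \<lambda>n\<in>N. c [^] i \<otimes> n \<otimes> inv (c [^] i)) \<in> hom integer_group (AutoGroup (G\<lparr>carrier := N\<rparr>))"
proof -
  interpret N: normal N G by fact
  let ?\<phi> = "\<lambda>i::int. \<lambda>n\<in>N. c [^] i \<otimes> n \<otimes> inv (c [^] i)"
  have mem: "?\<phi> i n \<in> N" if "n \<in> N" for i n
    using that c N.inv_op_closed2 by simp
  have comp: "?\<phi> i (?\<phi> j n) = ?\<phi> (i + j) n" if "n \<in> N" for i j n
    using that c mem[OF that, of j] by (simp add: int_pow_mult inv_mult_group m_assoc)
  have bij: "?\<phi> i \<in> Bij N" for i
  proof -
    have "bij_betw (?\<phi> i) N N"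
    proof (rule bij_betw_byWitness[where f' = "?\<phi> (- i)"])
      have "?\<phi> 0 n = n" if "n \<in> N" for n
        using that by simp
      then show "\<forall>n\<in>N. ?\<phi> (- i) (?\<phi> i n) = n" "\<forall>n\<in>N. ?\<phi> i (?\<phi> (- i) n) = n"
        using comp[of _ "- i" i] comp[of _ i "- i"] by (metis add.left_inverse, metis add.right_inverse)
    qed (use mem in blast)+
    then show ?thesis by (simp add: Bij_def)
  qed
  have "?\<phi> i \<in> auto (G\<lparr>carrier := N\<rparr>)" for i
  proof -
    have "c [^] i \<otimes> (m \<otimes> n) \<otimes> inv (c [^] i)
        = (c [^] i \<otimes> m \<otimes> inv (c [^] i)) \<otimes> (c [^] i \<otimes> n \<otimes> inv (c [^] i))"
      if "m \<in> N" "n \<in> N" for m n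
    proof -
      have "inv (c [^] i) \<otimes> (c [^] i \<otimes> (n \<otimes> inv (c [^] i))) = n \<otimes> inv (c [^] i)"
        using that c by (simp add: m_assoc[symmetric])
      then show ?thesis
        using that c by (simp add: m_assoc)
    qed
    then show ?thesis
      using bij[of i] mem by (auto simp: auto_def hom_def)
  qed
  moreover have "?\<phi> (i + j) = compose N (?\<phi> i) (?\<phi> j)" for i j
  proof (rule extensionalityI)
    show "?\<phi> (i + j) n = compose N (?\<phi> i) (?\<phi> j) n" if "n \<in> N" for n
      using comp[OF that, of i j] by (simp only: compose_eq[OF that])
  qed (rule restrict_extensional compose_extensional)+
  ultimately show ?thesis
    using bij by (intro homI) (simp_all add: AutoGroup_def BijGroup_def del: restrict_apply add: restrict_apply')
qed

text \<open>With \<open>x\<close> and \<open>y\<close> the powers of \<open>c\<close> given by two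
  degrees, this is the cocycle identity that makes the first component of the isomorphism compatible
  with products.\<close>

lemma (in group) conj_cocycle:
  assumes "p \<in> carrier G" "q \<in> carrier G" "x \<in> carrier G" "y \<in> carrier G"
  shows "(p \<otimes> inv x) \<otimes> (x \<otimes> (q \<otimes> inv y) \<otimes> inv x) = (p \<otimes> q) \<otimes> inv (x \<otimes> y)"
proof -
  have "inv x \<otimes> (x \<otimes> (q \<otimes> (inv y \<otimes> inv x))) = q \<otimes> (inv y \<otimes> inv x)"
    using assms by (simp add: m_assoc[symmetric])
  then show ?thesis
    using assms by (simp add: inv_mult_group m_assoc)
qed

context conj_closed_subset
begin

text \<open>Modulo the derived subgroup every \<open>q \<in> Q\<close> equals \<open>c\<close>, so a
  product of generators depends only on its degree. Normality makes the elements with this property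
  a subgroup of \<open>As\<close>.\<close>

lemma As_proj_mod_derived:
  assumes c: "c \<in> carrier G" and Q: "Q = conj_class G c" and g: "g \<in> carrier As"
  shows "As_proj g \<otimes> inv (c [^] As_degree g) \<in> derived G (carrier G)"
proof -
  interpret D: normal "derived G (carrier G)" G by (rule derived_self_is_normal)
  let ?D = "derived G (carrier G)"
  let ?B = "{g \<in> carrier As. As_proj g \<otimes> inv (c [^] As_degree g) \<in> ?D}"
  have "subgroup ?B As"
  proof (rule As.subgroupI)
    have "\<one>\<^bsub>As\<^esub> \<in> ?B" using D.one_closed by simp
    then show "?B \<noteq> {}" by blast
  next
    fix g assume g: "g \<in> ?B"
    let ?p = "As_proj g" and ?a = "c [^] As_degree g"
    \<comment> \<open>For the inverse of \<open>g\<close> the element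
      \<open>inv ?p \<otimes> ?a\<close> is needed; it is the inverse of
      \<open>?p \<otimes> inv ?a\<close>, conjugated by \<open>?a\<close>.\<close>
    have "inv ?a \<otimes> inv (?p \<otimes> inv ?a) \<otimes> ?a \<in> ?D"
      using g c by (intro D.inv_op_closed1) auto
    moreover have "inv ?a \<otimes> inv (?p \<otimes> inv ?a) \<otimes> ?a = inv ?p \<otimes> ?a"
      using g c by (simp add: inv_mult_group m_assoc[symmetric])
    ultimately show "inv\<^bsub>As\<^esub> g \<in> ?B"
      using g c by (simp add: int_pow_neg)
  next
    fix g h assume gh: "g \<in> ?B" "h \<in> ?B"
    let ?p = "As_proj g" and ?a = "c [^] As_degree g" and ?q = "As_proj h" and ?b = "c [^] As_degree h"
    have "(?p \<otimes> inv ?a) \<otimes> (?a \<otimes> (?q \<otimes> inv ?b) \<otimes> inv ?a) \<in> ?D"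
      using gh c by (intro D.m_closed[of "?p \<otimes> inv ?a"] D.inv_op_closed2) simp_all
    then have "(?p \<otimes> ?q) \<otimes> inv (?a \<otimes> ?b) \<in> ?D"
      using gh c by (simp add: conj_cocycle)
    then show "g \<otimes>\<^bsub>As\<^esub> h \<in> ?B"
      using gh c by (simp add: int_pow_mult)
  qed auto
  moreover have "As_gen q \<in> ?B" if q: "q \<in> Q" for q
  proof -
    obtain h where h: "h \<in> carrier G" "q = inv h \<otimes> c \<otimes> h"
      using q unfolding Q conj_class_def by blast
    \<comment> \<open>The quotient \<open>q \<otimes> inv c\<close> is the commutator of
      \<open>inv h\<close> and \<open>c\<close>.\<close>
    have "inv h \<otimes> c \<otimes> inv (inv h) \<otimes> inv c \<in> derived_set G (carrier G)"
      using inv_closed[OF h(1)] c by (intro UN_I) simp_all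
    then have "q \<otimes> inv c \<in> ?D"
      unfolding derived_def using h by (auto intro: generate.incl)
    with q c show ?thesis by simp
  qed
  ultimately show ?thesis
    using As_generated[of ?B g] g by blast
qed

text \<open>The integers are abelian, so commutators of lifts have degree zero; hence the image of
  the kernel of \<open>As_degree\<close> is a subgroup containing all commutators of
  \<open>G\<close>.\<close>

lemma derived_lift:
  assumes surj: "As_proj ` carrier As = carrier G" and n: "n \<in> derived G (carrier G)"
  obtains g where "g \<in> carrier As" "As_proj g = n" "As_degree g = 0"
proof -
  let ?K = "kernel As integer_group As_degree"
  have "subgroup (As_proj ` ?K) G"
    by (rule As_proj.subgroup_img_is_subgroup[OF As_degree.subgroup_kernel])
  moreover have "derived_set G (carrier G) \<subseteq> As_proj ` ?K"
  proof clarify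
    fix x y assume "x \<in> carrier G" "y \<in> carrier G"
    then have "x \<in> As_proj ` carrier As" "y \<in> As_proj ` carrier As"
      by (simp_all only: surj)
    then obtain g h where gh: "g \<in> carrier As" "h \<in> carrier As" "x = As_proj g" "y = As_proj h"
      by (elim imageE)
    let ?k = "g \<otimes>\<^bsub>As\<^esub> h \<otimes>\<^bsub>As\<^esub> inv\<^bsub>As\<^esub> g \<otimes>\<^bsub>As\<^esub> inv\<^bsub>As\<^esub> h"
    have "?k \<in> ?K" "As_proj ?k = x \<otimes> y \<otimes> inv x \<otimes> inv y"
      using gh by (simp_all add: kernel_def)
    then show "x \<otimes> y \<otimes> inv x \<otimes> inv y \<in> As_proj ` ?K"
      by (intro image_eqI[of _ _ ?k]) simp_all
  qed
  ultimately have "derived G (carrier G) \<subseteq> As_proj ` ?K"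
    unfolding derived_def by (intro generate_subgroup_incl)
  with n that show thesis
    by (auto simp: kernel_def)
qed

end

theorem proposition4p12:
  fixes G :: "('g, 'm) monoid_scheme"
    and \<Gamma> :: "'x set"
    and R :: "('x word \<times> 'x word) set"
    and \<iota> :: "'x \<Rightarrow> 'g"
    and a :: 'x
  assumes "group G"
    and "cbar_presentation G \<Gamma> R \<iota>"
    and "\<forall>x\<in>\<Gamma>. \<forall>y\<in>\<Gamma>. \<iota> x \<in> conj_class G (\<iota> y)"
    and "a \<in> \<Gamma>"
  shows "\<exists>\<phi> \<in> hom integer_group (AutoGroup (G\<lparr>carrier := derived G (carrier G)\<rparr>)).
      (\<forall>n \<in> derived G (carrier G). \<phi> 1 n = \<iota> a \<otimes>\<^bsub>G\<^esub> n \<otimes>\<^bsub>G\<^esub> inv\<^bsub>G\<^esub> (\<iota> a)) \<and>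
      associated_group (dehn_quandle G (\<iota> ` \<Gamma>)) (conj_op G)
        \<cong> semidirect_product (G\<lparr>carrier := derived G (carrier G)\<rparr>) integer_group \<phi>"
proof -
  interpret G: group G by fact
  have pres: "presentation_of G \<Gamma> R \<iota>"
    using assms(2) by (simp add: cbar_presentation_def)
  note \<iota>_closed = presentation_of_word_eval(1)[OF assms(1) pres]
  let ?c = "\<iota> a" and ?D = "derived G (carrier G)"
  have c: "?c \<in> carrier G" using \<iota>_closed assms(4) .
  have conj_trans: "inv\<^bsub>G\<^esub> g \<otimes>\<^bsub>G\<^esub> q \<otimes>\<^bsub>G\<^esub> g \<in> conj_class G x"
    if x: "x \<in> carrier G" and q: "q \<in> conj_class G x" and g: "g \<in> carrier G" for x q g
  proof -
    obtain h where h: "h \<in> carrier G" "q = inv\<^bsub>G\<^esub> h \<otimes>\<^bsub>G\<^esub> x \<otimes>\<^bsub>G\<^esub> h"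
      using q by (auto simp: conj_class_def)
    then have "inv\<^bsub>G\<^esub> g \<otimes>\<^bsub>G\<^esub> q \<otimes>\<^bsub>G\<^esub> g = inv\<^bsub>G\<^esub> (h \<otimes>\<^bsub>G\<^esub> g) \<otimes>\<^bsub>G\<^esub> x \<otimes>\<^bsub>G\<^esub> (h \<otimes>\<^bsub>G\<^esub> g)"
      using x g by (simp add: G.inv_mult_group G.m_assoc)
    with h g show ?thesis
      unfolding conj_class_def by blast
  qed
  \<comment> \<open>All generators are conjugate, so the Dehn quandle is the single class of
    \<open>\<iota> a\<close>.\<close>
  have "conj_class G (\<iota> x) \<subseteq> conj_class G ?c" if x: "x \<in> \<Gamma>" for x
    using conj_trans[OF c] assms(3,4) x by (auto simp: conj_class_def[of G "\<iota> x"])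
  then have Q: "dehn_quandle G (\<iota> ` \<Gamma>) = conj_class G ?c"
    using assms(4) by (auto simp: dehn_quandle_def)
  interpret conj_closed_subset G "conj_class G ?c"
  proof
    show "conj_class G ?c \<subseteq> carrier G" using c by (auto simp: conj_class_def)
  qed (rule conj_trans[OF c])
  have \<iota>Q: "\<iota> x \<in> conj_class G ?c" if "x \<in> \<Gamma>" for x
    using assms(3,4) that by blast
  \<comment> \<open>The image is a subgroup containing every \<open>\<iota> x\<close>, and these
    generate \<open>G\<close>.\<close>
  have proj_surj: "As_proj ` carrier As = carrier G"
  proof -
    have "word_eval G \<iota> w \<in> As_proj ` carrier As" if "w \<in> words \<Gamma>" for w
    proof (rule G.word_eval_in_subgroup[OF As_proj.img_is_subgroup _ that])
      show "\<iota> x \<in> As_proj ` carrier As" if "x \<in> \<Gamma>" for x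
        using As_proj_gen[OF \<iota>Q[OF that]] As_gen_closed[OF \<iota>Q[OF that]] by (metis imageI)
    qed
    then have "word_eval G \<iota> ` words \<Gamma> \<subseteq> As_proj ` carrier As"
      by (rule image_subsetI)
    then show ?thesis
      unfolding presentation_of_word_eval(2)[OF assms(1) pres]
      using subgroup.subset[OF As_proj.img_is_subgroup] by (rule subset_antisym[rotated])
  qed
  interpret D: normal ?D G by (rule G.derived_self_is_normal)
  \<comment> \<open>A left action, as the product in \<open>semidirect_product\<close> requires;
    \<open>conj_op\<close> conjugates from the other side.\<close>
  define \<phi> where "\<phi> = (\<lambda>i::int. \<lambda>n\<in>?D. ?c [^]\<^bsub>G\<^esub> i \<otimes>\<^bsub>G\<^esub> n \<otimes>\<^bsub>G\<^esub> inv\<^bsub>G\<^esub> (?c [^]\<^bsub>G\<^esub> i))"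
  let ?S = "semidirect_product (G\<lparr>carrier := ?D\<rparr>) integer_group \<phi>"
  \<comment> \<open>Dividing by the power of \<open>\<iota> a\<close> of equal degree brings the
    projection into the derived subgroup, by \<open>As_proj_mod_derived\<close>.\<close>
  define F where "F g = (As_proj g \<otimes>\<^bsub>G\<^esub> inv\<^bsub>G\<^esub> (?c [^]\<^bsub>G\<^esub> As_degree g), As_degree g)" for g
  have F_mem: "fst (F g) \<in> ?D" if "g \<in> carrier As" for g
    using As_proj_mod_derived[OF c _ that] by (simp add: F_def)
  have "F \<in> iso As ?S"
  proof (rule isoI)
    show "F \<in> hom As ?S"
    proof (rule homI)
      show "F g \<in> carrier ?S" if "g \<in> carrier As" for g
        using F_mem[OF that] by (simp add: semidirect_product_def F_def)
      fix g h assume gh: "g \<in> carrier As" "h \<in> carrier As"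
      let ?p = "As_proj g" and ?a = "?c [^]\<^bsub>G\<^esub> As_degree g"
        and ?q = "As_proj h" and ?b = "?c [^]\<^bsub>G\<^esub> As_degree h"
      have "(?p \<otimes>\<^bsub>G\<^esub> inv\<^bsub>G\<^esub> ?a) \<otimes>\<^bsub>G\<^esub> (?a \<otimes>\<^bsub>G\<^esub> (?q \<otimes>\<^bsub>G\<^esub> inv\<^bsub>G\<^esub> ?b) \<otimes>\<^bsub>G\<^esub> inv\<^bsub>G\<^esub> ?a)
          = (?p \<otimes>\<^bsub>G\<^esub> ?q) \<otimes>\<^bsub>G\<^esub> inv\<^bsub>G\<^esub> (?a \<otimes>\<^bsub>G\<^esub> ?b)"
        using gh c by (intro G.conj_cocycle) simp_all
      then show "F (g \<otimes>\<^bsub>As\<^esub> h) = F g \<otimes>\<^bsub>?S\<^esub> F h"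
        using gh c F_mem[OF gh(2)]
        by (simp add: F_def semidirect_product_def \<phi>_def G.int_pow_mult)
    qed
    show "bij_betw F (carrier As) (carrier ?S)"
    proof (rule bij_betw_imageI)
      show "inj_on F (carrier As)"
      proof (rule inj_onI)
        fix g h assume gh: "g \<in> carrier As" "h \<in> carrier As" and eq: "F g = F h"
        \<comment> \<open>Equal degrees give equal powers of \<open>?c\<close>, which cancel in the
          first component.\<close>
        then have deg: "As_degree g = As_degree h" and proj: "As_proj g = As_proj h"
          using c by (auto simp: F_def)
        have "g \<otimes>\<^bsub>As\<^esub> inv\<^bsub>As\<^esub> h = \<one>\<^bsub>As\<^esub>"
          using gh deg proj \<iota>Q
          by (intro As_proj_degree_kernel_trivial[OF assms(2,4)]) auto
        then show "g = h"
          using gh As.inv_solve_right'[of "\<one>\<^bsub>As\<^esub>" g h] by simp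
      qed
      show "F ` carrier As = carrier ?S"
      proof
        show "F ` carrier As \<subseteq> carrier ?S"
          using F_mem by (auto simp: semidirect_product_def F_def)
        show "carrier ?S \<subseteq> F ` carrier As"
        proof
          fix s assume "s \<in> carrier ?S"
          then obtain n i where s: "s = (n, i)" and n: "n \<in> ?D"
            by (auto simp: semidirect_product_def)
          obtain g where g: "g \<in> carrier As" "As_proj g = n" "As_degree g = 0"
            using derived_lift[OF proj_surj n] .
          \<comment> \<open>Multiplying the lift of \<open>n\<close> by the \<open>i\<close>-th
            power of \<open>?e\<close> raises its degree from 0 to \<open>i\<close>, and
            \<open>F\<close> divides the extra factor out of the projection again.\<close>
          let ?e = "As_gen ?c"
          have e: "?e \<in> carrier As" using \<iota>Q[OF assms(4)] by simp
          have "As_degree (g \<otimes>\<^bsub>As\<^esub> ?e [^]\<^bsub>As\<^esub> i) = i"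
            using g e \<iota>Q[OF assms(4)] by (simp add: As_degree.hom_int_pow)
          moreover have "As_proj (g \<otimes>\<^bsub>As\<^esub> ?e [^]\<^bsub>As\<^esub> i) = n \<otimes>\<^bsub>G\<^esub> ?c [^]\<^bsub>G\<^esub> i"
            using g e \<iota>Q[OF assms(4)] by (simp add: As_proj.hom_int_pow)
          ultimately have "F (g \<otimes>\<^bsub>As\<^esub> ?e [^]\<^bsub>As\<^esub> i) = s"
            using c n by (simp add: F_def s G.m_assoc)
          then show "s \<in> F ` carrier As"
            using g e by (metis As.int_pow_closed As.m_closed imageI)
        qed
      qed
    qed
  qed
  then have "As \<cong> ?S" by (rule is_isoI)
  moreover have "\<phi> \<in> hom integer_group (AutoGroup (G\<lparr>carrier := ?D\<rparr>))"
    unfolding \<phi>_def by (rule G.conj_power_hom_AutoGroup[OF G.derived_self_is_normal c])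
  moreover have "\<forall>n\<in>?D. \<phi> 1 n = ?c \<otimes>\<^bsub>G\<^esub> n \<otimes>\<^bsub>G\<^esub> inv\<^bsub>G\<^esub> ?c"
    using c by (simp add: \<phi>_def)
  ultimately show ?thesis
    unfolding Q by blast
qed

end
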